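(* $7\notin\mathcal{S}_{3s}(2,3)$; that is, there is no $3$-way $(v,3,2)$ Steiner trade of volume $7$ for any $v$.
   Context: Let $V$ be a set of $v$ elements and let $k,t$ be positive integers with $t<k<v$. A block is a $k$-subset of $V$. A $\mu$-way $(v,k,t)$ trade of volume $m$ is a family $T=\{T_1,\dots,T_\mu\}$ of $\mu$ pairwise disjoint collections of blocks, each $T_i$ consisting of exactly $m$ blocks, such that for every $t$-subset $S$ of $V$, the number of blocks of $T_i$ containing $S$ is the same for all $i$. It is a Steiner trade if every $t$-subset of $V$ is contained in at most one block of each $T_i$. $\mathcal{S}_{\mu s}(t,k)$ denotes the set of all positive integers $m$ such that a $\mu$-way $(v,k,t)$ Steiner trade of volume $m$ exists for some $v$. *)

theory Defs
  imports "HOL-Library.Disjoint_Sets" "HOL-Library.Ramsey"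
begin

text \<open>
  The ground set \<open>V\<close> carries the parameter \<open>v = card V\<close>; blocks are the members of \<open>nsets V k\<close>.
  The family \<open>T\<^sub>1, \<dots>, T\<^sub>\<mu>\<close> is the restriction of \<open>T\<close> to \<open>{1..\<mu>}\<close>; other values are irrelevant.
\<close>

definition way_trade ::
  "nat \<Rightarrow> 'a set \<Rightarrow> nat \<Rightarrow> nat \<Rightarrow> nat \<Rightarrow> (nat \<Rightarrow> 'a set set) \<Rightarrow> bool" where
  "way_trade \<mu> V k t m T \<longleftrightarrow>
     finite V \<and> 0 < t \<and> t < k \<and> k < card V \<and>
     (\<forall>i\<in>{1..\<mu>}. T i \<subseteq> nsets V k \<and> card (T i) = m) \<and>
     disjoint_family_on T {1..\<mu>} \<and>
     (\<forall>S\<in>nsets V t. \<forall>i\<in>{1..\<mu>}. \<forall>j\<in>{1..\<mu>}.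
        card {B \<in> T i. S \<subseteq> B} = card {B \<in> T j. S \<subseteq> B})"

definition way_steiner_trade ::
  "nat \<Rightarrow> 'a set \<Rightarrow> nat \<Rightarrow> nat \<Rightarrow> nat \<Rightarrow> (nat \<Rightarrow> 'a set set) \<Rightarrow> bool" where
  "way_steiner_trade \<mu> V k t m T \<longleftrightarrow>
     way_trade \<mu> V k t m T \<and>
     (\<forall>S\<in>nsets V t. \<forall>i\<in>{1..\<mu>}. card {B \<in> T i. S \<subseteq> B} \<le> 1)"

text \<open>
  Since ground sets are finite, letting \<open>V\<close> range over the finite sets of natural numbers
  covers every ground set up to relabelling of its points.
\<close>

definition steiner_volumes :: "nat \<Rightarrow> nat \<Rightarrow> nat \<Rightarrow> nat set" where
  "steiner_volumes \<mu> t k =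
     {m. 0 < m \<and> (\<exists>v. \<exists>V :: nat set. card V = v \<and> (\<exists>T. way_steiner_trade \<mu> V k t m T))}"

end

theory Submission
  imports Defs
begin

text \<open>
  Let \<open>r\<^sub>x\<close> be the number of blocks of \<open>T\<^sub>1\<close> through a point \<open>x\<close>. The three collections induce
  pairwise disjoint perfect matchings on the neighbours of \<open>x\<close>, so \<open>r\<^sub>x \<ge> 2\<close>, and if \<open>r\<^sub>x = 2\<close>
  then any two of the four neighbours of \<open>x\<close> form a covered pair.

  If the blocks through \<open>x\<close> are just \<open>xab\<close> and \<open>xcd\<close>, then \<open>ac\<close>, \<open>ad\<close>, \<open>bc\<close>, \<open>bd\<close> lie in four
  further blocks, whose third points are outside \<open>{x,a,b,c,d}\<close>; only one more block is left
  to give all outside points a second block, and this is impossible. Otherwise every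
  \<open>r\<^sub>x \<ge> 3\<close>; as the \<open>r\<^sub>x\<close> sum to 21, there are at most 7 points, and the collections are
  three pairwise disjoint Steiner triple systems on 7 points. These do not exist: the
  matchings of the first two at a point form a hexagon, and each of the four ways to choose
  the third matching forces a common block.
\<close>

section \<open>Partial triple systems and covered pairs\<close>

definition partial_triple_system :: "'a set set \<Rightarrow> bool" where
  "partial_triple_system T \<longleftrightarrow> (\<forall>X\<in>T. card X = 3) \<and>
     (\<forall>X\<in>T. \<forall>Y\<in>T. \<forall>u v. u \<noteq> v \<longrightarrow> {u, v} \<subseteq> X \<longrightarrow> {u, v} \<subseteq> Y \<longrightarrow> X = Y)"

text \<open>In a partial triple system a pair lies in 0 or 1 blocks, so this relation carries the
  same information as the block counts in the balance condition.\<close>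

definition covers :: "'a set set \<Rightarrow> 'a \<Rightarrow> 'a \<Rightarrow> bool" where
  "covers T u v \<longleftrightarrow> u \<noteq> v \<and> (\<exists>X\<in>T. {u, v} \<subseteq> X)"

lemma coversI: "X \<in> T \<Longrightarrow> u \<in> X \<Longrightarrow> v \<in> X \<Longrightarrow> u \<noteq> v \<Longrightarrow> covers T u v"
  by (auto simp: covers_def)

lemma card_3_insertE:
  assumes "card X = 3" "u \<in> X"
  obtains v w where "X = {u, v, w}" "distinct [u, v, w]"
proof -
  have "card (X - {u}) = 2" using assms by simp
  then obtain v w where "X - {u} = {v, w}" "v \<noteq> w" by (auto simp: card_2_iff)
  then show thesis using assms(2) by (intro that[of v w]) auto
qed

lemma triple_distinct:
  assumes "partial_triple_system T" "{u, v, w} \<in> T"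
  shows "distinct [u, v, w]"
proof -
  have "card {u, v, w} = 3" using assms by (simp add: partial_triple_system_def)
  then show ?thesis by (auto simp: card_insert_if split: if_splits)
qed

lemma block_unique:
  assumes "partial_triple_system T" "X \<in> T" "Y \<in> T" "u \<in> X" "v \<in> X" "u \<in> Y" "v \<in> Y" "u \<noteq> v"
  shows "X = Y"
  using assms unfolding partial_triple_system_def by blast

lemma third_point:
  assumes "partial_triple_system T" "covers T u v"
  obtains w where "{u, v, w} \<in> T" "distinct [u, v, w]"
proof -
  obtain X where X: "X \<in> T" "u \<in> X" "v \<in> X" "u \<noteq> v"
    using assms(2) by (auto simp: covers_def)
  obtain y z where yz: "X = {u, y, z}" "distinct [u, y, z]"
    using card_3_insertE X assms(1) by (metis partial_triple_system_def)
  then have "v = y \<or> v = z" using X by auto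
  then show thesis
  proof
    assume "v = y" then show thesis using that[of z] yz X by auto
  next
    assume "v = z" then show thesis using that[of y] yz X by (auto simp: insert_commute)
  qed
qed

lemma third_unique:
  assumes "partial_triple_system T" "{u, v, w} \<in> T" "{u, v, w'} \<in> T"
  shows "w = w'"
proof -
  have d: "distinct [u, v, w]" "distinct [u, v, w']" using assms triple_distinct by metis+
  then have "{u, v, w} = {u, v, w'}" using block_unique[OF assms, of u v] by auto
  then show ?thesis using d by auto
qed

text \<open>If \<open>z\<close> lay in \<open>{x, a, b}\<close>, then \<open>{p, q, z}\<close> would
  share \<open>p\<close> and \<open>z\<close> with that block and equal it. So \<open>q\<close>
  would lie in both blocks through \<open>x\<close>, which meet only in \<open>x\<close>. The other
  block is symmetric.\<close>

lemma transversal_third_point: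
  assumes T: "partial_triple_system T"
    and M: "{x, a, b} \<in> T" "{x, c, d} \<in> T" and ne: "{x, a, b} \<noteq> {x, c, d}"
    and pq: "p \<in> {a, b}" "q \<in> {c, d}" and z: "{p, q, z} \<in> T"
  shows "z \<notin> {x, a, b, c, d}"
proof -
  have dz: "distinct [p, q, z]" "distinct [x, a, b]" "distinct [x, c, d]"
    using triple_distinct T M z by metis+
  have meet: "u = x" if "u \<in> {x, a, b}" "u \<in> {x, c, d}" for u
    using block_unique[OF T M, of u x] ne that by auto
  have "z \<notin> {x, a, b}"
  proof
    assume "z \<in> {x, a, b}"
    then have "{p, q, z} = {x, a, b}"
      using pq dz by (intro block_unique[OF T z M(1), of p z]) auto
    then show False using meet[of q] dz pq by auto
  qed
  moreover have "z \<notin> {x, c, d}"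
  proof
    assume "z \<in> {x, c, d}"
    then have "{p, q, z} = {x, c, d}"
      using pq dz by (intro block_unique[OF T z M(2), of q z]) auto
    then show False using meet[of p] dz pq by auto
  qed
  ultimately show ?thesis by auto
qed

text \<open>This lets collections covering the same pairs be recognised as having the same
  points.\<close>

lemma Union_eq_covers:
  assumes "partial_triple_system T"
  shows "\<Union>T = {u. \<exists>v. covers T u v}"
proof -
  have "\<exists>v. covers T u v" if u: "u \<in> X" "X \<in> T" for u X
  proof -
    obtain v w where "X = {u, v, w}" "distinct [u, v, w]"
      using card_3_insertE u assms by (metis partial_triple_system_def)
    then have "covers T u v" using u by (auto simp: covers_def)
    then show ?thesis by blast
  qed
  then show ?thesis by (auto simp: covers_def)
qed

section \<open>Disjoint Steiner triple systems on seven points\<close>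

definition triple_system :: "'a set set \<Rightarrow> 'a set \<Rightarrow> bool" where
  "triple_system T P \<longleftrightarrow> partial_triple_system T \<and> \<Union>T \<subseteq> P \<and>
     (\<forall>u\<in>P. \<forall>v\<in>P. u \<noteq> v \<longrightarrow> covers T u v)"

lemma third_point_in:
  assumes "triple_system T P" "u \<in> P" "v \<in> P" "u \<noteq> v"
  obtains w where "w \<in> P" "{u, v, w} \<in> T" "distinct [u, v, w]"
proof -
  have T: "partial_triple_system T" "covers T u v" "\<Union>T \<subseteq> P"
    using assms by (auto simp: triple_system_def)
  obtain w where w: "{u, v, w} \<in> T" "distinct [u, v, w]" using third_point[OF T(1,2)] .
  then show thesis using that T(3) by blast
qed

text \<open>The third points of the pairs \<open>ac\<close>, \<open>ad\<close>, \<open>bd\<close>,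
  \<open>bc\<close> can only be \<open>e\<close> or \<open>f\<close>, and pairs sharing a point need
  different ones. The choices thus form a proper 2-colouring of a 4-cycle, of which there are
  two.\<close>

lemma fano_completion:
  assumes T: "triple_system T {x, a, b, c, d, e, f}"
    and d: "distinct [x, a, b, c, d, e, f]"
    and M: "{x, a, b} \<in> T" "{x, c, d} \<in> T"
  shows "({a, c, e} \<in> T \<and> {a, d, f} \<in> T \<and> {b, c, f} \<in> T \<and> {b, d, e} \<in> T) \<or>
         ({a, c, f} \<in> T \<and> {a, d, e} \<in> T \<and> {b, c, e} \<in> T \<and> {b, d, f} \<in> T)"
proof -
  have T': "partial_triple_system T" using T by (simp add: triple_system_def)
  have ne: "{x, a, b} \<noteq> {x, c, d}" using d by auto
  have step: "{p, q, e} \<in> T \<or> {p, q, f} \<in> T" if pq: "p \<in> {a, b}" "q \<in> {c, d}" for p q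
  proof -
    have "p \<in> {x, a, b, c, d, e, f}" "q \<in> {x, a, b, c, d, e, f}" "p \<noteq> q" using pq d by auto
    then obtain z where z: "z \<in> {x, a, b, c, d, e, f}" "{p, q, z} \<in> T"
      using third_point_in[OF T] by metis
    then show ?thesis using transversal_third_point[OF T' M ne pq z(2)] by auto
  qed
  have clash1: "\<not> ({p, q, z} \<in> T \<and> {p, q', z} \<in> T)" if "q \<noteq> q'" for p q q' z
    using third_unique[OF T', of p z q q'] that by (auto simp: insert_commute)
  have clash2: "\<not> ({p, q, z} \<in> T \<and> {p', q, z} \<in> T)" if "p \<noteq> p'" for p p' q z
    using third_unique[OF T', of q z p p'] that by (auto simp: insert_commute)
  have "c \<noteq> d" "a \<noteq> b" using d by auto
  then show ?thesis
    using step[of a c] step[of a d] step[of b c] step[of b d]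
      clash1[of c d] clash2[of a b] by blast
qed

text \<open>The matchings of \<open>A\<close> and \<open>B\<close> at \<open>x\<close> alternate
  along the hexagon \<open>a b c d e f\<close>. The matching of \<open>C\<close> avoids its edges,
  and each system then has only two completions.\<close>

lemma hexagon_no_third:
  assumes d: "distinct [x, a, b, c, d, e, f]"
    and P: "P = {x, a, b, c, d, e, f}"
    and S: "triple_system A P" "triple_system B P" "triple_system C P"
    and disj: "A \<inter> B = {}" "A \<inter> C = {}" "B \<inter> C = {}"
    and MA: "{x, a, b} \<in> A" "{x, c, d} \<in> A" "{x, e, f} \<in> A"
    and MB: "{x, b, c} \<in> B" "{x, d, e} \<in> B" "{x, f, a} \<in> B"
  shows False
proof -
  have C: "partial_triple_system C" using S by (simp add: triple_system_def)
  have dAB: "X \<notin> B" and dAC: "X \<notin> C" if "X \<in> A" for X using that disj by auto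
  have dBC: "X \<notin> C" if "X \<in> B" for X using that disj by auto
  define n where "n = (\<lambda>u v. {x, u, v} \<in> C)"
  have sym: "n u v \<longleftrightarrow> n v u" for u v by (simp add: n_def insert_commute)
  have uni: "v = w" if "n u v" "n u w" for u v w
    using third_unique[OF C, of x u v w] that by (simp add: n_def)
  have hex: "\<not> n a b" "\<not> n c d" "\<not> n e f" "\<not> n b c" "\<not> n d e" "\<not> n f a"
    using dAC[OF MA(1)] dAC[OF MA(2)] dAC[OF MA(3)] dBC[OF MB(1)] dBC[OF MB(2)] dBC[OF MB(3)]
    by (simp_all add: n_def)
  have partner: "\<exists>v\<in>{a, b, c, d, e, f} - {u}. n u v" if u: "u \<in> {a, b, c, d, e, f}" for u
  proof -
    have "x \<in> P" "u \<in> P" "x \<noteq> u" using u d by (auto simp: P)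
    then obtain w where "w \<in> P" "{x, u, w} \<in> C" "distinct [x, u, w]"
      using third_point_in[OF S(3)] by metis
    then show ?thesis by (auto simp: P n_def)
  qed
  have pa: "n a c \<or> n a d \<or> n a e" using partner[of a] hex sym by auto
  have pb: "n b d \<or> n b e \<or> n b f" using partner[of b] hex sym by auto
  have pc: "n c a \<or> n c e \<or> n c f" using partner[of c] hex sym by auto
  have pd: "n d a \<or> n d b \<or> n d f" using partner[of d] hex sym by auto
  have pe: "n e a \<or> n e b \<or> n e c" using partner[of e] hex sym by auto
  have pf: "n f b \<or> n f c \<or> n f d" using partner[of f] hex sym by auto
  have ne: "distinct [a, b, c, d, e, f]" using d by simp
  \<comment> \<open>The complement of the hexagon is a triangular prism. Its perfect matchings are
    the three long diagonals, or one long diagonal with the two short ones that join the remaining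
    vertices.\<close>
  consider "n a d" "n b e" "n c f" | "n a d" "n b f" "n c e"
    | "n a c" "n b e" "n d f" | "n a e" "n b d" "n c f"
    using pa pb pc pd pe pf ne uni sym unfolding distinct.simps list.set by (smt (verit) insertCI)
  note matching = this
  have fA: "({a, c, e} \<in> A \<and> {a, d, f} \<in> A \<and> {b, c, f} \<in> A \<and> {b, d, e} \<in> A) \<or>
         ({a, c, f} \<in> A \<and> {a, d, e} \<in> A \<and> {b, c, e} \<in> A \<and> {b, d, f} \<in> A)"
    using S(1) d MA unfolding P by (intro fano_completion) auto
  \<comment> \<open>The same completion, with the labels rotated one vertex along the
    hexagon.\<close>
  have fB: "({b, d, f} \<in> B \<and> {b, e, a} \<in> B \<and> {c, d, a} \<in> B \<and> {c, e, f} \<in> B) \<or>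
         ({b, d, a} \<in> B \<and> {b, e, f} \<in> B \<and> {c, d, f} \<in> B \<and> {c, e, a} \<in> B)"
    using S(2) d MB unfolding P
    by (intro fano_completion[of B x b c d e f a]) (auto simp: insert_commute)
  have fC: "({p, r, t} \<in> C \<and> {p, s, u} \<in> C \<and> {q, r, u} \<in> C \<and> {q, s, t} \<in> C) \<or>
         ({p, r, u} \<in> C \<and> {p, s, t} \<in> C \<and> {q, r, t} \<in> C \<and> {q, s, u} \<in> C)"
    if "n p q" "n r s" "{x, p, q, r, s, t, u} = {x, a, b, c, d, e, f}"
       "distinct [x, p, q, r, s, t, u]" for p q r s t u
    using S(3) that unfolding P n_def by (intro fano_completion[of C x]) auto
  \<comment> \<open>In each case the two completions of \<open>A\<close>, \<open>B\<close> and
    \<open>C\<close> give eight combinations, and in every one some block lies in two of the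
    systems.\<close>
  show False
    using matching
  proof cases
    case 1
    have "{x, a, d, b, e, c, f} = {x, a, b, c, d, e, f}" "distinct [x, a, d, b, e, c, f]"
      using d by auto
    from fC[OF 1(1,2) this] fA fB show False
      by (auto dest: dAB dAC dBC simp: insert_commute)
  next
    case 2
    have "{x, a, d, b, f, c, e} = {x, a, b, c, d, e, f}" "distinct [x, a, d, b, f, c, e]"
      using d by auto
    from fC[OF 2(1,2) this] fA fB show False
      by (auto dest: dAB dAC dBC simp: insert_commute)
  next
    case 3
    have "{x, a, c, b, e, d, f} = {x, a, b, c, d, e, f}" "distinct [x, a, c, b, e, d, f]"
      using d by auto
    from fC[OF 3(1,2) this] fA fB show False
      by (auto dest: dAB dAC dBC simp: insert_commute)
  next
    case 4
    have "{x, a, e, b, d, c, f} = {x, a, b, c, d, e, f}" "distinct [x, a, e, b, d, c, f]"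
      using d by auto
    from fC[OF 4(1,2) this] fA fB show False
      by (auto dest: dAB dAC dBC simp: insert_commute)
  qed
qed

text \<open>Two disjoint perfect matchings on six points form even cycles of length at least 4,
  hence one hexagon. What remains is to relabel the points along it.\<close>

lemma no_three_disjoint_fano_planes:
  assumes d: "distinct [x, a, b, c, d, e, f]"
    and P: "P = {x, a, b, c, d, e, f}"
    and S: "triple_system A P" "triple_system B P" "triple_system C P"
    and disj: "A \<inter> B = {}" "A \<inter> C = {}" "B \<inter> C = {}"
    and MA: "{x, a, b} \<in> A" "{x, c, d} \<in> A" "{x, e, f} \<in> A"
  shows False
proof -
  have B: "partial_triple_system B" using S by (simp add: triple_system_def)
  have dAB: "X \<notin> B" if "X \<in> A" for X using that disj by auto
  define n where "n = (\<lambda>u v. {x, u, v} \<in> B)"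
  have sym: "n u v \<longleftrightarrow> n v u" for u v by (simp add: n_def insert_commute)
  have uni: "v = w" if "n u v" "n u w" for u v w
    using third_unique[OF B, of x u v w] that by (simp add: n_def)
  have partner: "\<exists>v\<in>{a, b, c, d, e, f} - {u}. n u v" if u: "u \<in> {a, b, c, d, e, f}" for u
  proof -
    have "x \<in> P" "u \<in> P" "x \<noteq> u" using u d by (auto simp: P)
    then obtain w where "w \<in> P" "{x, u, w} \<in> B" "distinct [x, u, w]"
      using third_point_in[OF S(2)] by metis
    then show ?thesis by (auto simp: P n_def)
  qed
  have hexagon: False if h: "n b' c'" "n d' e'" "n f' a'"
      "{x, a', b'} \<in> A" "{x, c', d'} \<in> A" "{x, e', f'} \<in> A"
      "distinct [x, a', b', c', d', e', f']" "P = {x, a', b', c', d', e', f'}"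
      for a' b' c' d' e' f'
    using hexagon_no_third[OF h(7,8) S disj h(4-6)] h(1-3) by (simp add: n_def)
  \<comment> \<open>Here \<open>c'\<close> is the \<open>B\<close>-partner of \<open>b\<close>, and
    \<open>d'\<close> is the \<open>A\<close>-partner of \<open>c'\<close>. The primes allow any of
    the four possible partners of \<open>b\<close>.\<close>
  have nbc: "\<not> n b c'" if h: "{x, c', d'} \<in> A" "{x, e', f'} \<in> A"
      "distinct [x, a, b, c', d', e', f']" "P = {x, a, b, c', d', e', f'}"
      for c' d' e' f'
  proof
    assume bc: "n b c'"
    have A: "\<not> n a b" "\<not> n c' d'" "\<not> n e' f'"
      using dAB[OF MA(1)] dAB[OF h(1)] dAB[OF h(2)] by (simp_all add: n_def)
    have set: "{a, b, c, d, e, f} = {a, b, c', d', e', f'}"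
    proof -
      have "{a, b, c, d, e, f} = P - {x}" using d by (auto simp: P)
      moreover have "{a, b, c', d', e', f'} = P - {x}"
        using h(3) by (auto simp: h(4))
      ultimately show ?thesis by simp
    qed
    have bc': "\<not> n v b" "\<not> n v c'" if "v \<noteq> b" "v \<noteq> c'" for v
      using that bc uni sym by metis+
    have pd: "n d' a \<or> n d' e' \<or> n d' f'"
      using partner[of d'] bc'[of d'] A sym h(3) unfolding set by auto
    have pe: "n e' a \<or> n e' d'"
      using partner[of e'] bc'[of e'] A sym h(3) unfolding set by auto
    have pf: "n f' a \<or> n f' d'"
      using partner[of f'] bc'[of f'] A sym h(3) unfolding set by auto
    have "a \<noteq> d'" "e' \<noteq> f'" "a \<noteq> e'" "a \<noteq> f'" "e' \<noteq> d'" "f' \<noteq> d'" using h(3) by auto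
    \<comment> \<open>Matching \<open>d'\<close> with \<open>a\<close> would leave \<open>e'\<close>
      and \<open>f'\<close> to each other, although they are matched in \<open>A\<close>. The two
      cases traverse the edge \<open>e' f'\<close> in opposite directions.\<close>
    then consider "n d' e'" "n f' a" | "n d' f'" "n e' a"
      using pd pe pf uni sym by metis
    then show False
    proof cases
      case 1
      then show False using hexagon[OF bc 1 MA(1) h(1,2) h(3,4)] by simp
    next
      case 2
      show False
        using h(2-4) by (intro hexagon[OF bc 2 MA(1) h(1)]) (auto simp: insert_commute)
    qed
  qed
  have "\<not> n b a" using dAB[OF MA(1)] by (simp add: n_def insert_commute)
  then have "n b c \<or> n b d \<or> n b e \<or> n b f" using partner[of b] by auto
  moreover have "\<not> n b c" using MA(2,3) d P by (intro nbc) auto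
  moreover have "\<not> n b d"
    using MA(2,3) d P by (intro nbc[of d c e f]) (auto simp: insert_commute)
  moreover have "\<not> n b e"
    using MA(2,3) d P by (intro nbc[of e f c d]) (auto simp: insert_commute)
  moreover have "\<not> n b f"
    using MA(2,3) d P by (intro nbc[of f e c d]) (auto simp: insert_commute)
  ultimately show False by blast
qed

section \<open>Local structure of a three-way trade at a point\<close>

locale three_way_trade =
  fixes A B C :: "'a set set"
  assumes A: "partial_triple_system A"
    and B: "partial_triple_system B"
    and C: "partial_triple_system C"
    and covers_B: "covers B = covers A"
    and covers_C: "covers C = covers A"
    and AB: "A \<inter> B = {}" and AC: "A \<inter> C = {}" and BC: "B \<inter> C = {}"
begin

text \<open>The block of \<open>B\<close> on \<open>x\<close> and \<open>a\<close> has a third point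
  \<open>z\<close> other than \<open>b\<close>, as \<open>A\<close> and \<open>B\<close> are
  disjoint. The pair \<open>xz\<close> is covered by \<open>A\<close> too, necessarily in a block
  other than \<open>X\<close>.\<close>

lemma second_block:
  assumes "X \<in> A" "x \<in> X"
  obtains Y where "Y \<in> A" "x \<in> Y" "Y \<noteq> X"
proof -
  obtain a b where X: "X = {x, a, b}" "distinct [x, a, b]"
    using card_3_insertE assms A by (metis partial_triple_system_def)
  have "covers A x a" using X assms by (auto simp: covers_def)
  then obtain z where z: "{x, a, z} \<in> B" "distinct [x, a, z]"
    using third_point[OF B] covers_B by metis
  then have "covers B x z" by (auto simp: covers_def)
  then obtain Y where Y: "Y \<in> A" "x \<in> Y" "z \<in> Y"
    unfolding covers_B by (auto simp: covers_def)
  have "z \<noteq> b" using z X assms AB by auto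
  then have "Y \<noteq> X" using X z Y by auto
  then show thesis using that Y by blast
qed

text \<open>The third points of \<open>xa\<close> in \<open>B\<close> and in \<open>C\<close> are
  neighbours of \<open>x\<close> other than \<open>b\<close>, so both lie in \<open>{c, d}\<close>.
  They differ because \<open>B\<close> and \<open>C\<close> are disjoint, so one of them is
  \<open>c\<close>.\<close>

lemma neighbours_covered:
  assumes X: "{x, a, b} \<in> A" and Y: "{x, c, d} \<in> A" and ne: "{x, a, b} \<noteq> {x, c, d}"
    and only: "\<And>Z. Z \<in> A \<Longrightarrow> x \<in> Z \<Longrightarrow> Z = {x, a, b} \<or> Z = {x, c, d}"
  shows "covers A a c"
proof -
  have d: "distinct [x, a, b]" "distinct [x, c, d]" using triple_distinct A X Y by metis+
  have xa: "covers A x a" using X d by (auto simp: covers_def)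
  have nbr: "z \<in> {c, d}" if z: "{x, a, z} \<in> T" "partial_triple_system T" "covers T = covers A"
      "A \<inter> T = {}" for T z
  proof -
    have dz: "distinct [x, a, z]" using triple_distinct z by metis
    then have "covers T x z" using z(1) by (auto simp: covers_def)
    then obtain Z where Z: "Z \<in> A" "x \<in> Z" "z \<in> Z"
      unfolding z(3) by (auto simp: covers_def)
    have "z \<noteq> b" using z X by auto
    then show ?thesis using only[OF Z(1,2)] Z dz by auto
  qed
  obtain y where y: "{x, a, y} \<in> B" using third_point[OF B] xa covers_B by metis
  obtain z where z: "{x, a, z} \<in> C" using third_point[OF C] xa covers_C by metis
  have "y \<noteq> z" using y z BC by auto
  moreover have "y \<in> {c, d}" "z \<in> {c, d}"
    using nbr[OF y B covers_B AB] nbr[OF z C covers_C AC] by auto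
  ultimately consider "y = c" | "z = c" by auto
  then show ?thesis
  proof cases
    case 1
    have "covers B a c" using triple_distinct[OF B y] 1 by (intro coversI[OF y]) auto
    then show ?thesis by (simp add: covers_B)
  next
    case 2
    have "covers C a c" using triple_distinct[OF C z] 2 by (intro coversI[OF z]) auto
    then show ?thesis by (simp add: covers_C)
  qed
qed

text \<open>This is the case where \<open>ad\<close> and \<open>bc\<close> share their third point.
  Both \<open>p\<close> and \<open>s\<close> need \<open>D\<close> as second block, and a second
  block for the remaining point of \<open>D\<close> forces that point to be \<open>q\<close>. Now
  \<open>p\<close> has only two blocks, so \<open>a\<close> and \<open>s\<close> must be covered,
  but no block contains both.\<close>

lemma no_degree_2_config:
  assumes d: "distinct [x, a, b, c, d, p, q, s]"
    and A_eq: "A = {D, {x, a, b}, {x, c, d}, {a, c, p}, {a, d, q}, {b, c, q}, {b, d, s}}"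
    and D: "x \<notin> D"
  shows False
proof -
  have DA: "D \<in> A" by (simp add: A_eq)
  have acp: "{a, c, p} \<in> A" and bds: "{b, d, s} \<in> A" by (simp_all add: A_eq)
  have "p \<in> D"
    using second_block[OF acp, of p] d unfolding A_eq by auto
  moreover have "s \<in> D"
    using second_block[OF bds, of s] d unfolding A_eq by auto
  ultimately obtain z where z: "D = {p, s, z}" "distinct [p, s, z]"
  proof -
    assume pD: "p \<in> D" and sD: "s \<in> D"
    have "covers A p s" using pD sD DA d by (auto simp: covers_def)
    then obtain z where z: "{p, s, z} \<in> A" "distinct [p, s, z]" using third_point[OF A] by metis
    have "D = {p, s, z}" using pD sD d by (intro block_unique[OF A DA z(1), of p s]) auto
    then show thesis using that z by blast
  qed
  have "z \<notin> {a, c}"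
  proof
    assume "z \<in> {a, c}"
    then have "{a, c, p} = D" using z by (intro block_unique[OF A acp DA, of p z]) auto
    then have "s \<in> {a, c, p}" using z by auto
    then show False using d by auto
  qed
  moreover have "z \<notin> {b, d}"
  proof
    assume "z \<in> {b, d}"
    then have "{b, d, s} = D" using z by (intro block_unique[OF A bds DA, of s z]) auto
    then have "p \<in> {b, d, s}" using z by auto
    then show False using d by auto
  qed
  moreover have "z \<noteq> x" using D z by auto
  moreover obtain Y where Y: "Y \<in> A" "z \<in> Y" "Y \<noteq> D" using second_block[OF DA, of z] z by auto
  moreover have "Y \<subseteq> {x, a, b, c, d, p, q, s}" using Y(1,3) unfolding A_eq by auto
  ultimately have zq: "z = q" using z by auto
  have "covers A a s"
  proof (rule neighbours_covered[of p a c s q])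
    show "{p, a, c} \<in> A" using acp by (simp add: insert_commute)
    show "{p, s, q} \<in> A" using DA z zq by simp
    show "{p, a, c} \<noteq> {p, s, q}" using d by auto
    show "Z = {p, a, c} \<or> Z = {p, s, q}" if "Z \<in> A" "p \<in> Z" for Z
      using that d z zq unfolding A_eq by auto
  qed
  then show False using d z zq unfolding A_eq covers_def by auto
qed

text \<open>Third points of pairs with a common point differ, so the only possible coincidences are
  \<open>p = s\<close> and \<open>q = r\<close>. The seventh block \<open>D\<close> is analysed for
  both, exactly one, or none of them.\<close>

lemma no_degree_2:
  assumes card7: "card A = 7"
    and X: "{x, a, b} \<in> A" and Y: "{x, c, d} \<in> A" and ne: "{x, a, b} \<noteq> {x, c, d}"
    and only: "\<And>Z. Z \<in> A \<Longrightarrow> x \<in> Z \<Longrightarrow> Z = {x, a, b} \<or> Z = {x, c, d}"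
  shows False
proof -
  have "distinct [x, a, b]" "distinct [x, c, d]" using triple_distinct A X Y by metis+
  moreover have "u = x" if "u \<in> {x, a, b}" "u \<in> {x, c, d}" for u
    using block_unique[OF A X Y, of u x] ne that by auto
  ultimately have d: "distinct [x, a, b, c, d]" by auto
  have nc: "covers A a c" using neighbours_covered[OF X Y ne only] .
  have cov: "covers A u v" if "u \<in> {a, b}" "v \<in> {c, d}" for u v
    using that nc neighbours_covered[of x a b d c] neighbours_covered[of x b a c d]
      neighbours_covered[of x b a d c] X Y ne only by (auto simp: insert_commute)
  have out: "z \<notin> {x, a, b, c, d}" if "u \<in> {a, b}" "v \<in> {c, d}" "{u, v, z} \<in> A" for u v z
    using transversal_third_point[OF A X Y ne] that by blast
  obtain p where p: "{a, c, p} \<in> A" using third_point[OF A cov] by blast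
  obtain q where q: "{a, d, q} \<in> A" using third_point[OF A cov] by blast
  obtain r where r: "{b, c, r} \<in> A" using third_point[OF A cov] by blast
  obtain s where s: "{b, d, s} \<in> A" using third_point[OF A cov] by blast
  have o: "p \<notin> {x, a, b, c, d}" "q \<notin> {x, a, b, c, d}" "r \<notin> {x, a, b, c, d}" "s \<notin> {x, a, b, c, d}"
    using out[OF _ _ p] out[OF _ _ q] out[OF _ _ r] out[OF _ _ s] by auto
  have pq: "p \<noteq> q" using third_unique[OF A, of a p c d] p q d by (auto simp: insert_commute)
  have pr: "p \<noteq> r" using third_unique[OF A, of c p a b] p r d by (auto simp: insert_commute)
  have qs: "q \<noteq> s" using third_unique[OF A, of d q a b] q s d by (auto simp: insert_commute)
  have rs: "r \<noteq> s" using third_unique[OF A, of b r c d] r s d by (auto simp: insert_commute)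
  define S where "S = {{x, a, b}, {x, c, d}, {a, c, p}, {a, d, q}, {b, c, r}, {b, d, s}}"
  have cS: "card S = 6"
  proof -
    let ?L = "[{x, a, b}, {x, c, d}, {a, c, p}, {a, d, q}, {b, c, r}, {b, d, s}]"
    \<comment> \<open>The traces on these four points are its six pairs, which shows that the six
      blocks are distinct.\<close>
    have "map (\<lambda>X. X \<inter> {a, b, c, d}) ?L = [{a, b}, {c, d}, {a, c}, {a, d}, {b, c}, {b, d}]"
      using d o by simp
    moreover have "distinct [{a, b}, {c, d}, {a, c}, {a, d}, {b, c}, {b, d}]"
      using d by (auto simp: doubleton_eq_iff)
    ultimately have "distinct ?L" by (metis distinct_map)
    from distinct_card[OF this] show ?thesis by (simp add: S_def)
  qed
  have SA: "S \<subseteq> A" using X Y p q r s by (simp add: S_def)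
  have "card (A - S) = 1" using cS SA card7 by (subst card_Diff_subset) (auto simp: S_def)
  then obtain D where D: "A - S = {D}" by (auto simp: card_1_singleton_iff)
  then have A_S: "A = insert D S" and DA: "D \<in> A" and DS: "D \<notin> S" using SA by auto
  have A_eq: "A = {D, {x, a, b}, {x, c, d}, {a, c, p}, {a, d, q}, {b, c, r}, {b, d, s}}"
    by (simp add: A_S S_def)
  have "D \<noteq> {x, a, b}" "D \<noteq> {x, c, d}"
    using DS unfolding S_def by (metis insertCI)+
  then have xD: "x \<notin> D" using only[OF DA] by metis
  have cD: "card D = 3" using A DA by (simp add: partial_triple_system_def)
  show False
  proof (cases "p = s")
    case ps: True
    show False
    proof (cases "q = r")
      case True
      have DZ: "\<not> (u \<in> D \<and> v \<in> D)" if "Z \<in> S" "u \<in> Z" "v \<in> Z" "u \<noteq> v" for u v Z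
        using block_unique[OF A DA, of Z u v] that SA DS by auto
      have "u \<in> {a, b, c, d, p, q}" if "u \<in> D" for u
        using second_block[OF DA that] ps True xD that unfolding A_eq by auto
      then have Dsub: "D \<subseteq> {a, b, c, d, p, q}" by blast
      \<comment> \<open>The six blocks of \<open>S\<close> already cover every pair from
        \<open>{a, b, c, d, p, q}\<close> except \<open>pq\<close>, so \<open>D\<close> has no room
        for three points.\<close>
      have meet: "\<not> (u \<in> D \<and> v \<in> D)" if uv: "u \<in> {a, b, c, d}" "v \<in> {a, b, c, d, p, q}" "u \<noteq> v" for u v
      proof -
        have "\<exists>Z\<in>S. u \<in> Z \<and> v \<in> Z" using uv ps True by (auto simp: S_def)
        then show ?thesis using DZ uv by blast
      qed
      have "card D \<le> 2"
      proof (cases "D \<inter> {a, b, c, d} = {}")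
        case True
        then have "D \<subseteq> {p, q}" using Dsub by auto
        then show ?thesis using card_mono[of "{p, q}" D] pq by simp
      next
        case False
        then obtain u where u: "u \<in> D" "u \<in> {a, b, c, d}" by blast
        then have "D \<subseteq> {u}" using meet[OF u(2)] Dsub by fast
        then show ?thesis using card_mono[of "{u}" D] by simp
      qed
      then show False using cD by simp
    next
      case False
      show False
      \<comment> \<open>Swapping \<open>c\<close> with \<open>d\<close> exchanges \<open>p\<close>
        with \<open>q\<close> and \<open>r\<close> with \<open>s\<close>, turning
        \<open>p = s\<close> into the coincidence treated before.\<close>
      proof (rule no_degree_2_config[of x a b d c q p r D])
        show "distinct [x, a, b, d, c, q, p, r]" using d o pq pr False by auto
        show "A = {D, {x, a, b}, {x, d, c}, {a, d, q}, {a, c, p}, {b, d, p}, {b, c, r}}"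
          using A_eq ps by (simp add: insert_commute)
        show "x \<notin> D" by (rule xD)
      qed
    qed
  next
    case ps: False
    show False
    proof (cases "q = r")
      case True
      show False
      proof (rule no_degree_2_config[of x a b c d p q s D])
        show "distinct [x, a, b, c, d, p, q, s]" using d o pq qs ps by auto
        show "A = {D, {x, a, b}, {x, c, d}, {a, c, p}, {a, d, q}, {b, c, q}, {b, d, s}}"
          using A_eq True by simp
        show "x \<notin> D" by (rule xD)
      qed
    next
      case False
      \<comment> \<open>Four distinct outside points lie in one block of \<open>S\<close> each, so
        all of them need \<open>D\<close>, which has only three points.\<close>
      have "p \<in> D" using second_block[OF p, of p] o pq pr ps unfolding A_eq by auto
      moreover have "q \<in> D" using second_block[OF q, of q] o pq qs False unfolding A_eq by auto
      moreover have "r \<in> D" using second_block[OF r, of r] o pr rs False unfolding A_eq by auto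
      moreover have "s \<in> D" using second_block[OF s, of s] o qs rs ps unfolding A_eq by auto
      ultimately have "{p, q, r, s} \<subseteq> D" by simp
      moreover have "card {p, q, r, s} = 4" using pq pr ps qs rs False by simp
      moreover have "finite D" using cD by (simp add: card_ge_0_finite)
      ultimately show False using card_mono[of D "{p, q, r, s}"] cD by simp
    qed
  qed
qed

section \<open>Counting points and reduction to seven\<close>

text \<open>Degree 1 is excluded by \<open>second_block\<close> and degree 2 by
  \<open>no_degree_2\<close>; distinct blocks through \<open>x\<close> meet only in
  \<open>x\<close>.\<close>

lemma three_blocks:
  assumes card7: "card A = 7" and x: "x \<in> \<Union>A"
  obtains a b c d e f where "distinct [x, a, b, c, d, e, f]"
    "{x, a, b} \<in> A" "{x, c, d} \<in> A" "{x, e, f} \<in> A"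
proof -
  have form: "\<exists>u v. Z = {x, u, v} \<and> distinct [x, u, v]" if "Z \<in> A" "x \<in> Z" for Z
    using card_3_insertE that A by (metis partial_triple_system_def)
  obtain X where X: "X \<in> A" "x \<in> X" using x by blast
  then obtain Y where Y: "Y \<in> A" "x \<in> Y" "Y \<noteq> X" using second_block by metis
  obtain a b where ab: "X = {x, a, b}" "distinct [x, a, b]" using form X by blast
  obtain c d where cd: "Y = {x, c, d}" "distinct [x, c, d]" using form Y by blast
  obtain Z where Z: "Z \<in> A" "x \<in> Z" "Z \<noteq> X" "Z \<noteq> Y"
    using no_degree_2[OF card7, of x a b c d] X Y ab cd by blast
  obtain e f where ef: "Z = {x, e, f}" "distinct [x, e, f]" using form Z by blast
  have "u = x" if "U \<in> A" "W \<in> A" "U \<noteq> W" "x \<in> U" "x \<in> W" "u \<in> U" "u \<in> W" for u U W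
    using block_unique[OF A, of U W u x] that by blast
  then have "X \<inter> Y \<subseteq> {x}" "X \<inter> Z \<subseteq> {x}" "Y \<inter> Z \<subseteq> {x}" using X Y Z by blast+
  then have "distinct [x, a, b, c, d, e, f]" using ab cd ef by auto
  then show thesis using that X Y Z ab cd ef by blast
qed

text \<open>Double counting of incidences: every point lies on at least three blocks, and the 7
  blocks have 21 incidences.\<close>

lemma card_Union_le_7:
  assumes card7: "card A = 7"
  shows "finite (\<Union>A)" "card (\<Union>A) \<le> 7"
proof -
  have finA: "finite A" using card7 by (simp add: card_ge_0_finite)
  have c3: "card X = 3" if "X \<in> A" for X using A that by (simp add: partial_triple_system_def)
  have fin: "finite X" if "X \<in> A" for X using c3[OF that] by (simp add: card_ge_0_finite)
  show finU: "finite (\<Union>A)" using finA fin by blast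
  have deg: "3 \<le> card {X \<in> A. x \<in> X}" if x: "x \<in> \<Union>A" for x
  proof -
    obtain a b c d e f where d: "distinct [x, a, b, c, d, e, f]"
      and M: "{x, a, b} \<in> A" "{x, c, d} \<in> A" "{x, e, f} \<in> A"
      using three_blocks[OF card7 x] .
    have "card {{x, a, b}, {x, c, d}, {x, e, f}} = 3"
    proof -
      have "distinct [{x, a, b}, {x, c, d}, {x, e, f}]" using d by auto
      from distinct_card[OF this] show ?thesis by simp
    qed
    moreover have "{{x, a, b}, {x, c, d}, {x, e, f}} \<subseteq> {X \<in> A. x \<in> X}" using M by auto
    moreover have "finite {X \<in> A. x \<in> X}" using finA by simp
    ultimately show ?thesis using card_mono by metis
  qed
  have "3 * card (\<Union>A) \<le> (\<Sum>x\<in>\<Union>A. card {X \<in> A. x \<in> X})"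
    using sum_mono[of "\<Union>A" "\<lambda>_. 3" "\<lambda>x. card {X \<in> A. x \<in> X}"] deg by simp
  also have "\<dots> = 3 * card A"
  proof (rule sum_multicount[OF finU finA])
    have "{x \<in> \<Union>A. x \<in> X} = X" if "X \<in> A" for X using that by blast
    then show "\<forall>X\<in>A. card {x \<in> \<Union>A. x \<in> X} = 3" using c3 by simp
  qed
  finally show "card (\<Union>A) \<le> 7" using card7 by simp
qed

lemma volume_ne_7: "card A \<noteq> 7"
proof
  assume card7: "card A = 7"
  \<comment> \<open>Three blocks through one point already exhaust the at most seven points, so each
    point is covered with every other.\<close>
  have pts: "\<Union>A = {x, a, b, c, d, e, f}"
    if "distinct [x, a, b, c, d, e, f]" "{x, a, b} \<in> A" "{x, c, d} \<in> A" "{x, e, f} \<in> A"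
    for x a b c d e f
  proof (rule sym, rule card_seteq)
    show "{x, a, b, c, d, e, f} \<subseteq> \<Union>A" using that by blast
    have "card {x, a, b, c, d, e, f} = 7" using that distinct_card[of "[x, a, b, c, d, e, f]"] by simp
    then show "card (\<Union>A) \<le> card {x, a, b, c, d, e, f}"
      using card_Union_le_7[OF card7] by simp
  qed (use card_Union_le_7[OF card7] in simp)
  have cov: "covers A u v" if uv: "u \<in> \<Union>A" "v \<in> \<Union>A" "u \<noteq> v" for u v
  proof -
    obtain a b c d e f where *: "distinct [u, a, b, c, d, e, f]"
      "{u, a, b} \<in> A" "{u, c, d} \<in> A" "{u, e, f} \<in> A"
      using three_blocks[OF card7 uv(1)] .
    have "v \<in> {u, a, b, c, d, e, f}" using uv(2) unfolding pts[OF *] .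
    then show ?thesis using *(2-4) uv(3) unfolding covers_def by auto
  qed
  have sys: "triple_system A (\<Union>A)" "triple_system B (\<Union>A)" "triple_system C (\<Union>A)"
    using A B C cov covers_B covers_C Union_eq_covers[OF A] Union_eq_covers[OF B]
      Union_eq_covers[OF C] by (simp_all add: triple_system_def)
  have "A \<noteq> {}" using card7 by auto
  then obtain X where X: "X \<in> A" by blast
  then have "X \<noteq> {}" using A by (auto simp: partial_triple_system_def)
  then obtain x where "x \<in> \<Union>A" using X by blast
  then obtain a b c d e f where *: "distinct [x, a, b, c, d, e, f]"
    "{x, a, b} \<in> A" "{x, c, d} \<in> A" "{x, e, f} \<in> A"
    using three_blocks[OF card7] by metis
  show False using no_three_disjoint_fano_planes[OF *(1) pts[OF *] sys AB AC BC *(2-4)] .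
qed

end

section \<open>From Steiner trades to the locale\<close>

lemma steiner_trade_volume_ne_7: "\<not> way_steiner_trade 3 V 3 2 7 T"
proof
  assume asm: "way_steiner_trade 3 V 3 2 7 T"
  then have finV: "finite V" and TV: "\<And>i. i \<in> {1..3} \<Longrightarrow> T i \<subseteq> nsets V 3"
    and card7: "\<And>i. i \<in> {1..3} \<Longrightarrow> card (T i) = 7"
    and disj: "disjoint_family_on T {1..3}"
    and bal: "\<And>S i j. S \<in> nsets V 2 \<Longrightarrow> i \<in> {1..3} \<Longrightarrow> j \<in> {1..3} \<Longrightarrow>
        card {X \<in> T i. S \<subseteq> X} = card {X \<in> T j. S \<subseteq> X}"
    and le1: "\<And>S i. S \<in> nsets V 2 \<Longrightarrow> i \<in> {1..3} \<Longrightarrow> card {X \<in> T i. S \<subseteq> X} \<le> 1"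
    unfolding way_steiner_trade_def way_trade_def by blast+
  \<comment> \<open>Cardinality 7 rules out the default value 0 that \<open>card\<close> takes on
    infinite sets.\<close>
  have fin: "finite (T i)" if "i \<in> {1..3}" for i
    using card7[OF that] by (simp add: card_ge_0_finite)
  have blk: "X \<subseteq> V" "card X = 3" if "i \<in> {1..3}" "X \<in> T i" for i X
    using TV[OF that(1)] that(2) by (auto simp: nsets_def)
  have pair: "{u, v} \<in> nsets V 2" if "i \<in> {1..3}" "X \<in> T i" "{u, v} \<subseteq> X" "u \<noteq> v" for i X u v
    using blk[OF that(1,2)] that(3,4) by (auto simp: nsets_def)
  have pts: "partial_triple_system (T i)" if i: "i \<in> {1..3}" for i
    unfolding partial_triple_system_def
  proof (intro conjI ballI allI impI)
    show "card X = 3" if "X \<in> T i" for X using blk i that by blast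
    show "X = Y" if *: "X \<in> T i" "Y \<in> T i" "u \<noteq> v" "{u, v} \<subseteq> X" "{u, v} \<subseteq> Y" for X Y u v
    proof -
      have "card {Z \<in> T i. {u, v} \<subseteq> Z} \<le> 1" using le1 pair i * by blast
      moreover have "finite {Z \<in> T i. {u, v} \<subseteq> Z}" using fin[OF i] by simp
      ultimately show ?thesis using * by (auto simp: card_le_Suc0_iff_eq)
    qed
  qed
  have cov_imp: "covers (T j) u v" if ij: "i \<in> {1..3}" "j \<in> {1..3}"
    and c: "covers (T i) u v" for i j u v
  proof -
    obtain X where X: "X \<in> T i" "{u, v} \<subseteq> X" "u \<noteq> v" using c by (auto simp: covers_def)
    \<comment> \<open>Balance is used only through whether the count is zero, which yields equality
      of the relations \<open>covers\<close>.\<close>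
    have "card {Z \<in> T i. {u, v} \<subseteq> Z} \<noteq> 0" using X fin[OF ij(1)] by auto
    then have "card {Z \<in> T j. {u, v} \<subseteq> Z} \<noteq> 0" using bal[OF pair[OF ij(1) X] ij] by simp
    then have "{Z \<in> T j. {u, v} \<subseteq> Z} \<noteq> {}" by (metis card.empty)
    then show ?thesis using X(3) by (auto simp: covers_def)
  qed
  have cov: "covers (T j) = covers (T i)" if "i \<in> {1..3}" "j \<in> {1..3}" for i j
    using cov_imp that by (intro ext) blast
  have "three_way_trade (T 1) (T 2) (T 3)"
    using pts cov disj by unfold_locales (auto simp: disjoint_family_on_def)
  then show False using three_way_trade.volume_ne_7 card7[of 1] by fastforce
qed

theorem theorem3p3:
  shows "7 \<notin> steiner_volumes 3 2 3 \<and>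
    (\<forall>v. \<not> (\<exists>(V :: 'a set) T. card V = v \<and> way_steiner_trade 3 V 3 2 7 T))"
  by (simp add: steiner_volumes_def steiner_trade_volume_ne_7)

end
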